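(* Let $n\ge k\ge 0$ be integers. Then $$q^{\binom{k+1}{2}}\begin{bmatrix} n\\ k\end{bmatrix}_q\frac{(-q^{n-k+1};q)_k}{(q^{2n-k+1};q)_k}=\frac{q^{\binom{k+1}{2}}\begin{bmatrix} n-\lceil k/2\rceil\\ \lfloor k/2\rfloor\end{bmatrix}_{q^2}}{(q;q^2)_{\lceil k/2\rceil}\,(q^{2n-1};q^{-2})_{\lfloor k/2\rfloor}}.$$
   Context: Notation: $(a;q)_m=\prod_{i=0}^{m-1}(1-aq^i)$, so $(q^{2n-1};q^{-2})_j=\prod_{i=0}^{j-1}(1-q^{2n-1-2i})$; and $\begin{bmatrix} N\\ m\end{bmatrix}_q=(q^{N-m+1};q)_m/(q;q)_m$ (Gaussian polynomial). *)

theory Defs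
  imports Complex_Main
begin

definition qpoch :: "'a::field \<Rightarrow> 'a \<Rightarrow> nat \<Rightarrow> 'a" where
  "qpoch a q m = (\<Prod>i<m. 1 - a * q ^ i)"

text \<open>The exponent \<open>N - m + 1\<close> is an integer, so that the value is 0 for \<open>m > N\<close> and
  \<open>q \<noteq> 0\<close>, as it should be; natural-number subtraction would truncate.
  The quotient is meaningful only where \<open>qpoch q q m \<noteq> 0\<close>.\<close>

definition gauss_binom :: "'a::field \<Rightarrow> nat \<Rightarrow> nat \<Rightarrow> 'a" where
  "gauss_binom q N m = qpoch (q powi (int N - int m + 1)) q m / qpoch q q m"

end

theory Submission
  imports Defs
begin

text \<open>Since \<open>(a;q)\<^sub>k (-a;q)\<^sub>k = (a\<^sup>2;q\<^sup>2)\<^sub>k\<close>, the numerator on the left is the product of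
  the \<open>1 - q\<^bsup>2m\<^esup>\<close> for \<open>n - k < m \<le> n\<close>. Among the \<open>k\<close> exponents \<open>2n, 2n - 1, \<dots>, 2n - k + 1\<close> of
  the denominator, \<open>\<lceil>k/2\<rceil>\<close> are even, and their factors cancel the top part of that product;
  the odd ones give \<open>(q\<^bsup>2n-1\<^esup>;q\<^bsup>-2\<^esup>)\<close>. Splitting \<open>(q;q)\<^sub>k\<close> by parity finishes the proof.\<close>

lemma qpoch_add: "qpoch a q (m + n) = qpoch a q m * qpoch (a * q ^ m) q n"
  by (induction n) (simp_all add: qpoch_def power_add mult_ac)

lemma qpoch_mult_uminus: "qpoch a q k * qpoch (- a) q k = qpoch (a\<^sup>2) (q\<^sup>2) k"
proof -
  have "(1 - a * q ^ i) * (1 - (- a) * q ^ i) = 1 - a\<^sup>2 * (q\<^sup>2) ^ i" for i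
    by (simp add: algebra_simps power2_eq_square power_mult_distrib)
  then show ?thesis
    by (simp add: qpoch_def flip: prod.distrib)
qed

text \<open>Even indices \<open>i\<close> give the first product and odd ones the second;
  \<open>k - k div 2\<close> is \<lceil>k/2\<rceil>, the number of even
  \<open>i < k\<close>.\<close>

lemma qpoch_parity_split:
  "qpoch a q k = qpoch a (q\<^sup>2) (k - k div 2) * qpoch (a * q) (q\<^sup>2) (k div 2)"
proof -
  have even: "qpoch a q (2 * m) = qpoch a (q\<^sup>2) m * qpoch (a * q) (q\<^sup>2) m" for m
  proof (induction m)
    case (Suc m)
    have "q ^ (2 * m) = (q\<^sup>2) ^ m" by (rule power_mult)
    with Suc show ?case by (simp add: qpoch_def mult_ac)
  qed (simp add: qpoch_def)
  show ?thesis
  proof (cases "even k")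
    case True
    then obtain m where "k = 2 * m" by (elim evenE)
    then show ?thesis using even by simp
  next
    case False
    then obtain m where k: "k = Suc (2 * m)" by (elim oddE) simp
    have "qpoch a q k = qpoch a q (2 * m) * (1 - a * (q\<^sup>2) ^ m)"
      by (simp add: k qpoch_def flip: power_mult)
    also have "\<dots> = qpoch a (q\<^sup>2) (Suc m) * qpoch (a * q) (q\<^sup>2) m"
      unfolding even by (simp add: qpoch_def mult_ac)
    finally show ?thesis by (simp add: k Suc_diff_le)
  qed
qed

text \<open>The same factors, read from the highest exponent down. Starting at \<open>a * q\<close>
  makes that exponent \<open>m\<close> instead of \<open>m - 1\<close>.\<close>

lemma qpoch_reverse:
  assumes "q \<noteq> 0"
  shows "qpoch (a * q) q m = qpoch (a * q ^ m) (inverse q) m"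
proof -
  have "(\<Prod>i<m. 1 - a * q * q ^ i) = (\<Prod>i<m. 1 - a * q * q ^ (m - Suc i))"
    by (rule prod.nat_diff_reindex[symmetric])
  also have "\<dots> = (\<Prod>i<m. 1 - a * q ^ m * inverse q ^ i)"
  proof (rule prod.cong)
    fix i assume "i \<in> {..<m}"
    then have "m = Suc (m - Suc i) + i" by simp
    then have "q ^ m = q * q ^ (m - Suc i) * q ^ i"
      by (metis power_Suc power_add)
    then show "1 - a * q * q ^ (m - Suc i) = 1 - a * q ^ m * inverse q ^ i"
      using assms by (simp add: power_inverse)
  qed simp
  finally show ?thesis by (simp add: qpoch_def)
qed

theorem mainTheorem7:
  fixes q :: "'a::field" and n k :: nat
  assumes "k \<le> n"
    and "qpoch q q k \<noteq> 0"
    and "qpoch (q ^ (2 * n - k + 1)) q k \<noteq> 0"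
  shows "q ^ ((k + 1) choose 2) * gauss_binom q n k
           * (qpoch (- (q ^ (n - k + 1))) q k / qpoch (q ^ (2 * n - k + 1)) q k)
         = (q ^ ((k + 1) choose 2) * gauss_binom (q ^ 2) (n - nat \<lceil>real k / 2\<rceil>) (nat \<lfloor>real k / 2\<rfloor>))
           / (qpoch q (q ^ 2) (nat \<lceil>real k / 2\<rceil>)
              * qpoch (q powi (2 * int n - 1)) (q powi (-2)) (nat \<lfloor>real k / 2\<rfloor>))"
proof (cases "q = 0")
  \<comment> \<open>Reversal needs an invertible \<open>q\<close>, so 0 is treated apart: for
    \<open>k > 0\<close> the prefactor kills both sides.\<close>
  case True
  show ?thesis
  proof (cases "k = 0")
    case True
    then show ?thesis by (simp add: gauss_binom_def qpoch_def)
  next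
    case False
    then have "(k + 1) choose 2 \<noteq> 0" by (simp add: binomial_eq_0_iff)
    with True show ?thesis by (simp add: power_0_left)
  qed
next
  case q: False
  define f c where "f = k div 2" and "c = k - k div 2"
  have k: "k = f + c" by (simp add: f_def c_def)
  have floor: "nat \<lfloor>real k / 2\<rfloor> = f"
    unfolding f_def by (metis floor_divide_of_nat_eq nat_int of_nat_numeral)
  have ceil: "nat \<lceil>real k / 2\<rceil> = c"
    unfolding c_def by linarith
  \<comment> \<open>\<open>E\<close> is the part to be cancelled, with exponents 2(n-c+1), ..., 2n.
    \<open>B\<close> holds the odd exponents of the denominator, and \<open>A\<close> the rest of
    the numerator, with exponents 2(n-k+1), ..., 2(n-c).\<close>
  define E where "E = qpoch (q ^ (2 * (n - c + 1))) (q\<^sup>2) c"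
  define B where "B = qpoch (q powi (2 * int n - 1)) (q powi (-2)) f"
  define A where "A = qpoch (q ^ (2 * (n - k + 1))) (q\<^sup>2) f"
  have num: "qpoch (q ^ (n - k + 1)) q k * qpoch (- (q ^ (n - k + 1))) q k = A * E"
  proof -
    have "n - k + 1 + f = n - c + 1" using assms(1) k by simp
    then have *: "q ^ (2 * (n - k + 1)) * (q\<^sup>2) ^ f = q ^ (2 * (n - c + 1))"
      by (metis power_add power_mult distrib_left)
    have "qpoch (q ^ (2 * (n - k + 1))) (q\<^sup>2) (f + c) = A * E"
      unfolding A_def E_def qpoch_add * ..
    then show ?thesis
      by (simp only: qpoch_mult_uminus k[symmetric] power_mult[symmetric] mult.commute)
  qed
  have den: "qpoch (q ^ (2 * n - k + 1)) q k = E * B"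
  proof -
    \<comment> \<open>Read downwards, the exponents start at the even number 2n, so index parity
      equals exponent parity for every \<open>k\<close>; the lowest exponent has no fixed
      parity.\<close>
    have "qpoch (q ^ (2 * n - k + 1)) q k = qpoch (q ^ (2 * n)) (inverse q) k"
      using qpoch_reverse[OF q, of "q ^ (2 * n - k)" k] assms(1)
      by (simp add: power_add[symmetric] mult.commute)
    also have "\<dots> = qpoch (q ^ (2 * n)) ((inverse q)\<^sup>2) c
                   * qpoch (q ^ (2 * n) * inverse q) ((inverse q)\<^sup>2) f"
      unfolding c_def f_def by (rule qpoch_parity_split)
    also have "q ^ (2 * n) * inverse q = q powi (2 * int n - 1)"
      using power_int_diff[of q "int (2 * n)" 1] power_int_of_nat[of q "2 * n"] q
      by (simp add: divide_inverse)
    also have "qpoch (q ^ (2 * n)) ((inverse q)\<^sup>2) c = E"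
    proof -
      \<comment> \<open>The even part is reversed back, now in base \<open>q\<^sup>2\<close>, to
        match the ascending form of \<open>E\<close>.\<close>
      have "2 * (n - c) + 2 * c = 2 * n" using assms(1) k by simp
      then have "q ^ (2 * (n - c)) * (q\<^sup>2) ^ c = q ^ (2 * n)"
        by (metis power_add power_mult)
      then show ?thesis
        using qpoch_reverse[of "q\<^sup>2" "q ^ (2 * (n - c))" c] q
        unfolding E_def by (simp add: power_inverse power2_eq_square mult_ac)
    qed
    also have "(inverse q)\<^sup>2 = q powi (-2)"
      by (simp add: power_int_minus power_inverse)
    finally show ?thesis unfolding B_def .
  qed
  have "q * q = q\<^sup>2" by (simp add: power2_eq_square)
  then have qq: "qpoch q q k = qpoch q (q\<^sup>2) c * qpoch (q\<^sup>2) (q\<^sup>2) f"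
    using qpoch_parity_split[of q q k] by (simp add: c_def f_def)
  have "int n - int k + 1 = int (n - k + 1)" using assms(1) by simp
  then have lhs: "gauss_binom q n k = qpoch (q ^ (n - k + 1)) q k / qpoch q q k"
    unfolding gauss_binom_def by (metis power_int_of_nat)
  \<comment> \<open>As \<open>c + f = k\<close>, the Gaussian numerator in base
    \<open>q\<^sup>2\<close> starts at exponent 2(n-k+1) in \<open>q\<close>, exactly as
    \<open>A\<close> does.\<close>
  have "int (n - c) - int f + 1 = int (n - k + 1)" using assms(1) k by simp
  then have rhs: "gauss_binom (q\<^sup>2) (n - c) f = A / qpoch (q\<^sup>2) (q\<^sup>2) f"
    unfolding gauss_binom_def A_def by (metis power_int_of_nat power_mult)
  \<comment> \<open>\<open>E\<close> divides the nonzero denominator on the left, which permits its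
    cancellation.\<close>
  have "E \<noteq> 0" using assms(3) den by auto
  have "gauss_binom q n k * (qpoch (- (q ^ (n - k + 1))) q k / qpoch (q ^ (2 * n - k + 1)) q k)
      = (A * E) / (qpoch q q k * (E * B))"
    unfolding lhs den num[symmetric] by simp
  also have "\<dots> = gauss_binom (q\<^sup>2) (n - c) f / (qpoch q (q\<^sup>2) c * B)"
    unfolding rhs qq using \<open>E \<noteq> 0\<close> by (simp add: mult_ac)
  finally show ?thesis
    unfolding floor ceil B_def by (simp only: mult.assoc times_divide_eq_right[symmetric])
qed

end
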